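(* Let $G$ be a connected graph of order $n\ge 2$, and write $\rho_1=\rho_1(G)$, $\rho_2=\rho_2(G)$. If $k$ is the minimum positive component of a unit distance Pareto eigenvector of $G$ corresponding to $\rho_2$, then $$2\rho_1-\rho_2\ \ge\ 2k(n-1),$$ and equality holds if and only if $G=K_2$ (the complete graph on two vertices).
   Context: All graphs are finite, undirected, simple and connected. The distance matrix $\mathcal{D}(G)$ of a graph $G$ on vertices $1,\dots,n$ is the $n\times n$ matrix whose $(i,j)$ entry is the length $d_{ij}$ of a shortest path from $i$ to $j$. A real number $\lambda$ is a Pareto eigenvalue of a real $n\times n$ matrix $A$ if there is a nonzero vector $\mathbf{x}\in\mathbb{R}^n$, $\mathbf{x}\ge 0$ (entrywise), with $A\mathbf{x}\ge\lambda\mathbf{x}$ (entrywise) and $\lambda=\frac{\mathbf{x}^TA\mathbf{x}}{\mathbf{x}^T\mathbf{x}}$; such $\mathbf{x}$ is called a Pareto eigenvector associated with $\lambda$. Distance Pareto eigenvalues (eigenvectors) of $G$ are the Pareto eigenvalues (eigenvectors) of $\mathcal{D}(G)$. Eigenvectors are understood to be unit vectors (Euclidean norm 1). $\rho_k(G)$ denotes the $k$-th largest element of the set of distinct distance Pareto eigenvalues of $G$. *)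

theory Defs
  imports "HOL-Analysis.Analysis" "Graph_Theory.Graph_Theory"
begin

text \<open>
  A finite simple graph is a symmetric digraph without loops and multiple arcs (locale
  \<^locale>\<open>graph\<close>); each undirected edge is a pair of opposite arcs.  The distance is the
  infimum of the walk costs when every arc has cost 1; \<open>graph_dist_Least\<close> below states that
  between connected vertices this is the least number of arcs of a path.
\<close>

definition graph_dist :: "('v, 'e) pre_digraph \<Rightarrow> 'v \<Rightarrow> 'v \<Rightarrow> real" where
  "graph_dist G u v = real_of_ereal (wf_digraph.\<mu> G (\<lambda>_. 1) u v)"

definition distance_matrix :: "('v::finite, 'e) pre_digraph \<Rightarrow> real ^ 'v ^ 'v" where
  "distance_matrix G = (\<chi> i j. graph_dist G i j)"

text \<open>The order on vectors is the library's componentwise one.\<close>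

definition pareto_eigenvector :: "real ^ 'n ^ 'n \<Rightarrow> real \<Rightarrow> real ^ 'n \<Rightarrow> bool" where
  "pareto_eigenvector A l x \<longleftrightarrow>
     x \<noteq> 0 \<and> 0 \<le> x \<and> l *\<^sub>R x \<le> A *v x \<and> l = (x \<bullet> (A *v x)) / (x \<bullet> x)"

definition pareto_eigenvalues :: "real ^ 'n ^ 'n \<Rightarrow> real set" where
  "pareto_eigenvalues A = {l. \<exists>x. pareto_eigenvector A l x}"

text \<open>
  The \<open>k\<close>-th largest element (counting from 1) of a set; it is unspecified if there is none.
  The finiteness condition is needed because \<^const>\<open>card\<close> of an infinite set is 0.
\<close>

definition kth_largest :: "nat \<Rightarrow> real set \<Rightarrow> real" where
  "kth_largest k S = (THE r. r \<in> S \<and> finite {s \<in> S. r < s} \<and> card {s \<in> S. r < s} + 1 = k)"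

definition distance_pareto_rho :: "nat \<Rightarrow> ('v::finite, 'e) pre_digraph \<Rightarrow> real" where
  "distance_pareto_rho k G = kth_largest k (pareto_eigenvalues (distance_matrix G))"

lemma graph_dist_Least:
  assumes "wf_digraph G" and "u \<rightarrow>\<^sup>*\<^bsub>G\<^esub> v"
  shows "graph_dist G u v = real (LEAST l. \<exists>p. pre_digraph.apath G u p v \<and> length p = l)"
proof -
  interpret wf_digraph G by fact
  define m where "m = (LEAST l. \<exists>p. apath u p v \<and> length p = l)"
  have cost: "awalk_cost (\<lambda>_. 1) p = real (length p)" for p
    by (induct p) auto
  obtain q where "apath u q v" using assms(2) by (auto simp: reachable_apath)
  then have "\<exists>l p. apath u p v \<and> length p = l" by blast
  then have "\<exists>p. apath u p v \<and> length p = m" unfolding m_def by (rule LeastI_ex)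
  then obtain p where p: "apath u p v" "length p = m" by blast
  have le: "m \<le> length w" if "awalk u w v" for w
  proof -
    have "apath u (awalk_to_apath w) v" using that by (rule apath_awalk_to_apath)
    then have "m \<le> length (awalk_to_apath w)"
      unfolding m_def by (intro Least_le) blast
    also have "\<dots> \<le> length w" using that 
    proof (induct rule: awalk_to_apath_induct)
      case (path p)
      then have "awalk_to_apath p = p" by (auto simp: awalk_to_apath.simps)
      then show ?case by simp
    next
      case (decomp p q r s)
      then have "p = q @ r @ s" by (auto elim: awalk_cyc_decompE)
      with decomp show ?case using step_awalk_to_apath[of _ p _ q r s] by simp
    qed
    finally show ?thesis .
  qed
  have "\<mu> (\<lambda>_. 1) u v = ereal (real m)"
    unfolding \<mu>_def cost using p le
    by (intro antisym INF_greatest INF_lower2[where i=p]) (auto simp: apath_def)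
  then show ?thesis by (simp add: graph_dist_def m_def)
qed

end

(*
  Let D be the distance matrix and x a unit Pareto eigenvector for rho_2. Enlarging the support of a
  Pareto eigenvector by one vertex strictly increases the attainable eigenvalue, so exactly one
  vertex j is missing from the support of x. For t >= 0, the Rayleigh quotient of x + t e_j gives
  rho_2 + 2 t (D x)_j <= rho_1 (1 + t^2). At t = 1 this is the inequality, since every off-diagonal
  distance is at least 1 and hence (D x)_j >= k (n - 1). If equality holds at t = 1, then comparison
  with t slightly below 1 yields rho_1 <= (D x)_j, so rho_2 <= 0, which forces a support of size 1.
*)

theory Submission
  imports Defs
begin

section \<open>Quadratic forms and one-sided variation\<close>

definition supp :: "real ^ 'n \<Rightarrow> 'n set" where
  "supp x = {i. x $ i \<noteq> 0}"

definition nonneg_symmetric :: "real ^ 'n ^ 'n \<Rightarrow> bool" where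
  "nonneg_symmetric A \<longleftrightarrow> transpose A = A \<and> (\<forall>i j. 0 \<le> A $ i $ j)"

lemma nonneg_vec_iff: "0 \<le> (x :: real ^ 'n) \<longleftrightarrow> (\<forall>i. 0 \<le> x $ i)"
  by (simp add: less_eq_vec_def)

lemma nonneg_mult_nonneg:
  assumes "nonneg_symmetric A" "0 \<le> x"
  shows "0 \<le> (A *v x) $ i"
  using assms
  by (auto simp: nonneg_symmetric_def nonneg_vec_iff matrix_vector_mult_def intro!: sum_nonneg)

lemma symmetric_inner:
  assumes "nonneg_symmetric A"
  shows "x \<bullet> (A *v y) = y \<bullet> (A *v x)"
  using assms
  by (metis nonneg_symmetric_def dot_lmul_matrix transpose_matrix_vector inner_commute)

text \<open>By symmetry the two cross terms coincide. Every variation below adds a multiple of a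
  single basis vector, so this expansion serves them all.\<close>

lemma quadratic_form_add_axis:
  assumes "nonneg_symmetric A"
  shows "(x + t *\<^sub>R axis j 1) \<bullet> (A *v (x + t *\<^sub>R axis j 1))
    = x \<bullet> (A *v x) + 2 * t * (A *v x) $ j + t\<^sup>2 * A $ j $ j"
proof -
  have "axis j 1 \<bullet> (A *v axis j 1) = A $ j $ j"
    by (simp add: inner_axis' matrix_vector_mult_basis column_def)
  then show ?thesis
    using symmetric_inner[OF assms, of x "axis j 1"]
    by (simp add: matrix_vector_right_distrib matrix_vector_mult_scaleR inner_add_left
        inner_add_right inner_axis' power2_eq_square algebra_simps)
qed

lemma square_norm_add_axis:
  fixes x :: "real ^ 'n"
  shows "(x + t *\<^sub>R axis j 1) \<bullet> (x + t *\<^sub>R axis j 1) = x \<bullet> x + 2 * t * x $ j + t\<^sup>2"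
  by (simp add: inner_add_left inner_add_right inner_axis' inner_axis power2_eq_square algebra_simps)

text \<open>Divide by \<open>t\<close> and let \<open>t\<close> tend to 0: this is the first-order
  condition at a one-sided maximum, in a form free of derivatives.\<close>

lemma nonpos_if_linear_le_quadratic:
  fixes a b :: real
  assumes "\<And>t. 0 < t \<Longrightarrow> t < 1 \<Longrightarrow> t * a \<le> t\<^sup>2 * b"
  shows "a \<le> 0"
proof (rule ccontr)
  assume "\<not> a \<le> 0"
  \<comment> \<open>With this \<open>d\<close>, the point \<open>t = a / d\<close> lies below 1 and
    \<open>2 * t * (\<bar>b\<bar> + 1) = a - t * a < a\<close>, so a single \<open>t\<close> already
    contradicts the assumption.\<close>
  define d where "d = 2 * (\<bar>b\<bar> + 1) + a"
  define t where "t = a / d"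
  have "0 < a" "a < d" using \<open>\<not> a \<le> 0\<close> by (simp_all add: d_def)
  then have t: "0 < t" "t < 1" "t * d = a"
    by (simp_all add: t_def)
  with assms[of t] have "a \<le> t * b"
    by (simp add: power2_eq_square mult.assoc)
  also have "\<dots> \<le> t * (\<bar>b\<bar> + 1)"
    using t by (intro mult_left_mono) auto
  also have "\<dots> \<le> a / 2"
    using t(3) mult_pos_pos[OF \<open>0 < t\<close> \<open>0 < a\<close>] unfolding d_def distrib_left by linarith
  finally show False using \<open>\<not> a \<le> 0\<close> by simp
qed

section \<open>Pareto eigenvectors and their supports\<close>

lemma pareto_eigenvectorD:
  assumes "pareto_eigenvector A l x"
  shows "x \<noteq> 0" "0 \<le> x" "0 \<le> x $ i" "l * x $ i \<le> (A *v x) $ i"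
    "x \<bullet> (A *v x) = l * (x \<bullet> x)" "0 < x \<bullet> x"
  using assms by (auto simp: pareto_eigenvector_def less_eq_vec_def)

text \<open>Complementary slackness: the Rayleigh equation says that the products of the entries of
  \<open>x\<close> with the nonnegative slacks sum to 0, so each product vanishes.\<close>

lemma pareto_eigenvector_on_supp:
  assumes "pareto_eigenvector A l x" "i \<in> supp x"
  shows "(A *v x) $ i = l * x $ i"
proof -
  note x = pareto_eigenvectorD[OF assms(1)]
  have "(\<Sum>i\<in>UNIV. x $ i * ((A *v x) $ i - l * x $ i)) = x \<bullet> (A *v x) - l * (x \<bullet> x)"
    by (simp add: inner_vec_def sum_subtractf sum_distrib_left algebra_simps)
  then have "(\<Sum>i\<in>UNIV. x $ i * ((A *v x) $ i - l * x $ i)) = 0"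
    using x(5) by simp
  then have "x $ i * ((A *v x) $ i - l * x $ i) = 0"
    using x(3,4) by (subst (asm) sum_nonneg_eq_0_iff) auto
  then show ?thesis using assms(2) by (simp add: supp_def)
qed

lemma pareto_eigenvector_inner:
  assumes "pareto_eigenvector A l x" "supp y \<subseteq> supp x"
  shows "y \<bullet> (A *v x) = l * (y \<bullet> x)"
proof -
  have "y $ i * (A *v x) $ i = l * (y $ i * x $ i)" for i
  proof (cases "y $ i = 0")
    case False
    then have "i \<in> supp x" using assms(2) by (auto simp: supp_def)
    then show ?thesis using pareto_eigenvector_on_supp[OF assms(1)] by simp
  qed simp
  then show ?thesis by (auto simp: inner_vec_def sum_distrib_left intro!: sum.cong)
qed

lemma inner_pos_if_supp:
  assumes "0 \<le> x" "0 \<le> y" "y \<noteq> 0" "supp y \<subseteq> supp x"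
  shows "0 < y \<bullet> (x :: real ^ 'n)"
proof -
  obtain i where i: "y $ i \<noteq> 0" using assms(3) by (auto simp: vec_eq_iff)
  then have "x $ i \<noteq> 0" using assms(4) by (auto simp: supp_def)
  with i assms(1,2) have "0 < y $ i * x $ i"
    by (metis mult_nonneg_nonneg mult_eq_0_iff nonneg_vec_iff order_le_less)
  also have "\<dots> \<le> (\<Sum>i\<in>UNIV. y $ i * x $ i)"
    using assms(1,2) by (intro member_le_sum) (auto simp: nonneg_vec_iff)
  finally show ?thesis by (simp add: inner_vec_def)
qed

text \<open>Pair the two vectors: \<open>m * (y \<bullet> x) \<le> x \<bullet> (A *v y) = y
  \<bullet> (A *v x) = l * (y \<bullet> x)\<close>, where the last equality uses the inclusion of
  supports. In particular, the support determines the eigenvalue.\<close>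

lemma pareto_eigenvalue_le_if_supp:
  assumes A: "nonneg_symmetric A"
    and x: "pareto_eigenvector A l x" and y: "pareto_eigenvector A m y"
    and "supp y \<subseteq> supp x"
  shows "m \<le> l"
proof -
  have pos: "0 < y \<bullet> x"
    using pareto_eigenvectorD[OF x] pareto_eigenvectorD[OF y] assms(4) by (intro inner_pos_if_supp)
  have "m * (y \<bullet> x) = (\<Sum>i\<in>UNIV. x $ i * (m * y $ i))"
    by (simp add: inner_vec_def sum_distrib_left algebra_simps)
  also have "\<dots> \<le> x \<bullet> (A *v y)"
    unfolding inner_vec_def using pareto_eigenvectorD[OF x] pareto_eigenvectorD[OF y]
    by (auto intro!: sum_mono mult_left_mono)
  also have "\<dots> = l * (y \<bullet> x)"
    using pareto_eigenvector_inner[OF x assms(4)] symmetric_inner[OF A] by metis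
  finally show ?thesis using pos by simp
qed

text \<open>There are only finitely many supports, and each carries at most one eigenvalue.\<close>

lemma finite_pareto_eigenvalues:
  fixes A :: "real ^ 'n ^ 'n"
  assumes "nonneg_symmetric A"
  shows "finite (pareto_eigenvalues A)"
proof -
  \<comment> \<open>The value is arbitrary at sets that are not supports; only an inclusion in the
    range of \<open>f\<close> is claimed.\<close>
  define f where "f J = (THE l. \<exists>x. pareto_eigenvector A l x \<and> supp x = J)" for J :: "'n set"
  have "f (supp x) = l" if "pareto_eigenvector A l x" for l x
    unfolding f_def using that
    by (intro the_equality) (auto intro!: antisym dest: pareto_eigenvalue_le_if_supp[OF assms])
  then have "pareto_eigenvalues A \<subseteq> range f"
    unfolding pareto_eigenvalues_def by (auto simp: image_iff)
  then show ?thesis by (rule finite_subset) simp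
qed

section \<open>Maximizers on faces and enlargement of the support\<close>

text \<open>
  The vector is a maximiser \<open>z\<close> of the quadratic form over the unit vectors of a face of the
  nonnegative orthant. Where \<open>z\<close> vanishes, nonnegativity of \<open>A\<close> suffices. On its support,
  one-sided variation gives \<open>(A z)\<^sub>i \<le> l z\<^sub>i\<close>, and these are equalities since
  \<open>z \<bullet> A z = l\<close>.
\<close>

lemma pareto_eigenvector_maximizer:
  fixes A :: "real ^ 'n ^ 'n"
  assumes A: "nonneg_symmetric A" and "J \<noteq> {}"
  obtains l z where "pareto_eigenvector A l z" "supp z \<subseteq> J"
    "\<And>w. 0 \<le> w \<Longrightarrow> supp w \<subseteq> J \<Longrightarrow> w \<bullet> (A *v w) \<le> l * (w \<bullet> w)"
proof -
  define C where "C = {w :: real ^ 'n. norm w = 1 \<and> 0 \<le> w \<and> supp w \<subseteq> J}"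
  have C_eq: "C = sphere 0 1 \<inter> (\<Inter>i. {w. 0 \<le> w $ i}) \<inter> (\<Inter>i\<in>-J. {w. w $ i = 0})"
    by (auto simp: C_def nonneg_vec_iff supp_def dist_norm)
  have "compact C"
    unfolding C_eq
    by (intro compact_Int_closed compact_sphere closed_INT ballI closed_Collect_le closed_Collect_eq
        continuous_intros)
  moreover obtain j where "j \<in> J" using assms(2) by auto
  then have "axis j 1 \<in> C"
    by (auto simp: C_def nonneg_vec_iff supp_def axis_def norm_axis_1[unfolded axis_def])
  moreover have "continuous_on C (\<lambda>w. w \<bullet> (A *v w))"
    by (intro continuous_intros)
  ultimately obtain z where z: "z \<in> C" and max: "\<And>w. w \<in> C \<Longrightarrow> w \<bullet> (A *v w) \<le> z \<bullet> (A *v z)"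
    using continuous_attains_sup[of C] by blast
  define l where "l = z \<bullet> (A *v z)"
  have z1: "z \<bullet> z = 1" and z0: "0 \<le> z" "supp z \<subseteq> J"
    using z by (auto simp: C_def norm_eq_1)
  have le: "w \<bullet> (A *v w) \<le> l * (w \<bullet> w)" if w: "0 \<le> w" "supp w \<subseteq> J" for w
  proof (cases "w = 0")
    case False
    define u where "u = (1 / norm w) *\<^sub>R w"
    have "u \<in> C" using w False by (auto simp: C_def u_def nonneg_vec_iff supp_def)
    from max[OF this] have "(w \<bullet> (A *v w)) / (norm w)\<^sup>2 \<le> l"
      by (simp add: u_def l_def matrix_vector_mult_scaleR power2_eq_square)
    then show ?thesis using False by (simp add: field_simps dot_square_norm)
  qed simp
  have first_order: "(A *v z) $ i \<le> l * z $ i" if "i \<in> J" for i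
  proof -
    have "t * (2 * ((A *v z) $ i - l * z $ i)) \<le> t\<^sup>2 * (l - A $ i $ i)" if "0 < t" for t
    proof -
      let ?w = "z + t *\<^sub>R axis i 1"
      have "0 \<le> ?w" "supp ?w \<subseteq> J"
        using z0 \<open>i \<in> J\<close> \<open>0 < t\<close> by (auto simp: nonneg_vec_iff supp_def axis_def split: if_splits)
      from le[OF this] show ?thesis
        unfolding quadratic_form_add_axis[OF A] square_norm_add_axis z1 l_def[symmetric]
        by (simp add: algebra_simps)
    qed
    from nonpos_if_linear_le_quadratic[OF this] show ?thesis by simp
  qed
  have nonneg: "0 \<le> z $ i * (l * z $ i - (A *v z) $ i)" for i
    using first_order[of i] z0
    by (cases "z $ i = 0") (auto simp: nonneg_vec_iff supp_def intro!: mult_nonneg_nonneg)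
  have "(\<Sum>i\<in>UNIV. z $ i * (l * z $ i - (A *v z) $ i)) = l * (z \<bullet> z) - z \<bullet> (A *v z)"
    by (simp add: inner_vec_def sum_subtractf sum_distrib_left algebra_simps)
  then have "z $ i * (l * z $ i - (A *v z) $ i) = 0" for i
    using nonneg z1 by (simp add: l_def sum_nonneg_eq_0_iff)
  then have "z $ i = 0 \<or> l * z $ i = (A *v z) $ i" for i
    by simp
  then have "l * z $ i \<le> (A *v z) $ i" for i
    using nonneg_mult_nonneg[OF A z0(1), of i] by (metis mult_zero_right order_refl)
  then have "pareto_eigenvector A l z"
    using z0 z1 by (auto simp: pareto_eigenvector_def less_eq_vec_def l_def)
  then show thesis using that z0(2) le by blast
qed

text \<open>Adding \<open>t\<close> times the basis vector at \<open>j\<close> raises the quadratic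
  form to first order in \<open>t\<close>, but the squared norm only to second order. Hence the
  maximum over the enlarged face exceeds \<open>l\<close>.\<close>

lemma pareto_eigenvalue_less_if_insert:
  assumes A: "nonneg_symmetric A" and off: "\<And>i j. i \<noteq> j \<Longrightarrow> 0 < A $ i $ j"
    and x: "pareto_eigenvector A l x" and j: "j \<notin> supp x"
  obtains m z where "pareto_eigenvector A m z" "supp z \<subseteq> insert j (supp x)" "l < m"
proof -
  note x' = pareto_eigenvectorD[OF x]
  obtain m z where z: "pareto_eigenvector A m z" "supp z \<subseteq> insert j (supp x)" and
    max: "\<And>w. 0 \<le> w \<Longrightarrow> supp w \<subseteq> insert j (supp x) \<Longrightarrow> w \<bullet> (A *v w) \<le> m * (w \<bullet> w)"
    using pareto_eigenvector_maximizer[OF A, of "insert j (supp x)"] by blast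
  have xj: "x $ j = 0" using j by (simp add: supp_def)
  obtain i where i: "x $ i \<noteq> 0" using x'(1) by (auto simp: vec_eq_iff)
  \<comment> \<open>The index \<open>i\<close> lies in the support and \<open>j\<close> does not, so
    the entry is off-diagonal. It makes the first-order gain \<open>(A *v x) $ j\<close>
    positive.\<close>
  have "0 < A $ j $ i * x $ i"
    using off[of j i] i xj x'(3)[of i] by (intro mult_pos_pos) (auto simp: less_le)
  also have "\<dots> \<le> (A *v x) $ j"
    unfolding matrix_vector_mult_def using A x'(3)
    by (auto simp: nonneg_symmetric_def intro!: member_le_sum)
  finally have c: "0 < (A *v x) $ j" .
  have "l < m"
  proof (rule ccontr)
    assume "\<not> l < m"
    have "t * (2 * (A *v x) $ j) \<le> t\<^sup>2 * (m - A $ j $ j)" if "0 < t" for t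
    proof -
      let ?w = "x + t *\<^sub>R axis j 1"
      have "0 \<le> ?w" "supp ?w \<subseteq> insert j (supp x)"
        using x'(3) \<open>0 < t\<close> by (auto simp: nonneg_vec_iff supp_def axis_def)
      from max[OF this] have "l * (x \<bullet> x) + 2 * t * (A *v x) $ j + t\<^sup>2 * A $ j $ j
          \<le> m * (x \<bullet> x) + t\<^sup>2 * m"
        unfolding quadratic_form_add_axis[OF A] square_norm_add_axis x'(5) xj
        by (simp add: algebra_simps)
      moreover have "m * (x \<bullet> x) \<le> l * (x \<bullet> x)"
        using \<open>\<not> l < m\<close> x'(6) by simp
      ultimately show ?thesis by (simp add: algebra_simps)
    qed
    from nonpos_if_linear_le_quadratic[OF this] show False using c by simp
  qed
  then show thesis using that z by blast
qed

section \<open>Ranks in the finite set of eigenvalues\<close>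

text \<open>Existence goes by adding a new minimum: it keeps all earlier ranks and itself takes the
  last one. Uniqueness holds because the number of larger elements strictly drops as the element
  grows.\<close>

lemma kth_largest_spec:
  assumes "finite S" "1 \<le> k" "k \<le> card S"
  shows "kth_largest k S \<in> S" "card {s \<in> S. kth_largest k S < s} + 1 = k"
proof -
  let ?P = "\<lambda>r. r \<in> S \<and> finite {s \<in> S. r < s} \<and> card {s \<in> S. r < s} + 1 = k"
  have "\<exists>r. ?P r"
    using assms
  proof (induction S arbitrary: k rule: finite_linorder_min_induct)
    case (insert a S)
    have "a \<notin> S" using insert by auto
    show ?case
    proof (cases "k \<le> card S")
      case True
      then obtain r where r: "r \<in> S" "card {s \<in> S. r < s} + 1 = k"
        using insert.IH insert.prems by blast
      then have "{s \<in> insert a S. r < s} = {s \<in> S. r < s}" using insert by auto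
      then show ?thesis using r insert by auto
    next
      case False
      then have "k = card S + 1" using insert \<open>a \<notin> S\<close> by simp
      moreover have "{s \<in> insert a S. a < s} = S" using insert by auto
      ultimately show ?thesis using insert by auto
    qed
  qed simp
  have less: "\<not> r < r'" if "?P r" "?P r'" for r r'
  proof
    assume "r < r'"
    then have "{s \<in> S. r' < s} \<subset> {s \<in> S. r < s}" using that by force
    then have "card {s \<in> S. r' < s} < card {s \<in> S. r < s}" using that by (intro psubset_card_mono) auto
    then show False using that by simp
  qed
  have "r = r'" if "?P r" "?P r'" for r r'
    using less[OF that] less[OF that(2,1)] by simp
  with \<open>\<exists>r. ?P r\<close> have "\<exists>!r. ?P r" by (rule ex_ex1I)
  from theI'[OF this] show "kth_largest k S \<in> S" "card {s \<in> S. kth_largest k S < s} + 1 = k"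
    by (auto simp: kth_largest_def)
qed

text \<open>Guarantees that the first and second largest eigenvalues exist: start from an
  eigenvector supported at one vertex and enlarge its support.\<close>

lemma two_le_card_pareto_eigenvalues:
  fixes A :: "real ^ 'n ^ 'n"
  assumes A: "nonneg_symmetric A" and off: "\<And>i j. i \<noteq> j \<Longrightarrow> 0 < A $ i $ j"
    and "2 \<le> CARD('n)"
  shows "2 \<le> card (pareto_eigenvalues A)"
proof -
  obtain a :: 'n where True by simp
  obtain l z where z: "pareto_eigenvector A l z" "supp z \<subseteq> {a}"
    by (rule pareto_eigenvector_maximizer[OF A insert_not_empty[of a "{}"]]) (rule that)
  have "UNIV \<noteq> {a}"
  proof
    assume "UNIV = {a}"
    then have "CARD('n) = card {a}" by (rule arg_cong)
    then show False using assms(3) by simp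
  qed
  then obtain j where "j \<notin> supp z" using z(2) by blast
  then obtain m y where "pareto_eigenvector A m y" "l < m"
    using pareto_eigenvalue_less_if_insert[OF A off z(1)] by blast
  then have "{l, m} \<subseteq> pareto_eigenvalues A" "card {l, m} = 2"
    using z by (auto simp: pareto_eigenvalues_def)
  then show ?thesis using card_mono[OF finite_pareto_eigenvalues[OF A], of "{l, m}"] by simp
qed

section \<open>The gap between the two largest Pareto eigenvalues\<close>

context
  fixes A :: "real ^ 'n ^ 'n" and r\<^sub>1 r\<^sub>2 :: real and x :: "real ^ 'n"
  assumes A: "nonneg_symmetric A" and off: "\<And>i j. i \<noteq> j \<Longrightarrow> 1 \<le> A $ i $ j"
    and card: "2 \<le> CARD('n)"
    and r\<^sub>1: "r\<^sub>1 = kth_largest 1 (pareto_eigenvalues A)"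
    and r\<^sub>2: "r\<^sub>2 = kth_largest 2 (pareto_eigenvalues A)"
    and x: "pareto_eigenvector A r\<^sub>2 x"
begin

lemma off_pos: "i \<noteq> j \<Longrightarrow> 0 < A $ i $ j"
  using off[of i j] by simp

lemma largest_pareto_eigenvalue:
  shows "r\<^sub>1 \<in> pareto_eigenvalues A" "s \<in> pareto_eigenvalues A \<Longrightarrow> s \<le> r\<^sub>1"
proof -
  have fin: "finite (pareto_eigenvalues A)" by (rule finite_pareto_eigenvalues[OF A])
  have "1 \<le> card (pareto_eigenvalues A)"
    using two_le_card_pareto_eigenvalues[OF A off_pos card] by linarith
  note spec = kth_largest_spec[OF fin order_refl this, folded r\<^sub>1]
  from spec(1) show "r\<^sub>1 \<in> pareto_eigenvalues A" .
  have "{s \<in> pareto_eigenvalues A. r\<^sub>1 < s} = {}" using spec(2) fin by simp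
  then show "s \<le> r\<^sub>1" if "s \<in> pareto_eigenvalues A" using that by force
qed

text \<open>The maximum over the whole orthant is itself a Pareto eigenvalue, hence at most
  \<open>r\<^sub>1\<close>.\<close>

lemma quadratic_form_le_largest:
  assumes "0 \<le> w"
  shows "w \<bullet> (A *v w) \<le> r\<^sub>1 * (w \<bullet> w)"
proof -
  obtain l z where l: "pareto_eigenvector A l z"
    and le: "\<And>w. 0 \<le> w \<Longrightarrow> w \<bullet> (A *v w) \<le> l * (w \<bullet> w)"
    using pareto_eigenvector_maximizer[OF A, of UNIV] by auto
  have "l \<le> r\<^sub>1" using l by (intro largest_pareto_eigenvalue) (auto simp: pareto_eigenvalues_def)
  then show ?thesis using le[OF assms] by (meson mult_right_mono inner_ge_zero order_trans)
qed

lemma card_greater_second: "card {s \<in> pareto_eigenvalues A. r\<^sub>2 < s} = 1"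
  using kth_largest_spec(2)[of "pareto_eigenvalues A" 2] finite_pareto_eigenvalues[OF A]
    two_le_card_pareto_eigenvalues[OF A off_pos card]
  by (simp add: r\<^sub>2)

text \<open>Full support would leave no eigenvalue above \<open>r\<^sub>2\<close>; two missing
  vertices would allow two successive enlargements and so two eigenvalues above it.\<close>

lemma supp_second_eigenvector:
  obtains j where "supp x = - {j}"
proof -
  have "supp x \<noteq> UNIV"
  proof
    assume "supp x = UNIV"
    then have "{s \<in> pareto_eigenvalues A. r\<^sub>2 < s} = {}"
      using pareto_eigenvalue_le_if_supp[OF A x] by (auto simp: pareto_eigenvalues_def not_less)
    then show False using card_greater_second by (metis card.empty zero_neq_one)
  qed
  then obtain j where j: "j \<notin> supp x" by blast
  have "i \<in> supp x" if "i \<noteq> j" for i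
  proof (rule ccontr)
    assume i: "i \<notin> supp x"
    obtain m z where z: "pareto_eigenvector A m z" "supp z \<subseteq> insert j (supp x)" "r\<^sub>2 < m"
      using pareto_eigenvalue_less_if_insert[OF A off_pos x j] by blast
    \<comment> \<open>The first enlargement adds at most \<open>j\<close>, so \<open>i\<close> is
      still available for the second.\<close>
    have "i \<notin> supp z" using z(2) i \<open>i \<noteq> j\<close> by blast
    then obtain m' z' where "pareto_eigenvector A m' z'" "m < m'"
      using pareto_eigenvalue_less_if_insert[OF A off_pos z(1)] by blast
    with z have "{m, m'} \<subseteq> {s \<in> pareto_eigenvalues A. r\<^sub>2 < s}" "card {m, m'} = 2"
      by (auto simp: pareto_eigenvalues_def)
    then have "2 \<le> card {s \<in> pareto_eigenvalues A. r\<^sub>2 < s}"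
      using finite_pareto_eigenvalues[OF A] card_mono[of "{s \<in> pareto_eigenvalues A. r\<^sub>2 < s}" "{m, m'}"]
      by simp
    then show False using card_greater_second by simp
  qed
  then have "supp x = - {j}" using j by auto
  then show thesis by (rule that)
qed

text \<open>All that enters about distances is symmetry, nonnegativity and the bound 1 for
  off-diagonal entries; the diagonal may be any nonnegative one.\<close>

lemma pareto_eigenvalue_gap:
  assumes norm: "norm x = 1" and k: "k = Min {x $ i | i. 0 < x $ i}"
  shows "2 * k * (real CARD('n) - 1) \<le> 2 * r\<^sub>1 - r\<^sub>2"
    and "2 * r\<^sub>1 - r\<^sub>2 = 2 * k * (real CARD('n) - 1) \<Longrightarrow> CARD('n) = 2"
proof -
  obtain j where supp: "supp x = - {j}" by (rule supp_second_eigenvector)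
  note x' = pareto_eigenvectorD[OF x]
  have xx: "x \<bullet> x = 1" using norm by (simp add: norm_eq_1)
  have pos: "0 < x $ i" if "i \<noteq> j" for i
    using supp that x'(3)[of i] by (auto simp: supp_def less_le)
  have xj: "x $ j = 0" using supp by (auto simp: supp_def)
  define c where "c = (A *v x) $ j"
  \<comment> \<open>Since \<open>x $ j = 0\<close>, the test vector has squared norm
    \<open>1 + t\<^sup>2\<close>; the nonnegative diagonal term is dropped.\<close>
  have test: "r\<^sub>2 + 2 * t * c \<le> r\<^sub>1 * (1 + t\<^sup>2)" if "0 \<le> t" for t
  proof -
    let ?w = "x + t *\<^sub>R axis j 1"
    have "0 \<le> ?w" using x'(3) that by (auto simp: nonneg_vec_iff axis_def)
    from quadratic_form_le_largest[OF this]
    have "r\<^sub>2 + 2 * t * c + t\<^sup>2 * A $ j $ j \<le> r\<^sub>1 * (1 + t\<^sup>2)"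
      unfolding quadratic_form_add_axis[OF A] square_norm_add_axis x'(5) xx xj c_def by simp
    moreover have "0 \<le> t\<^sup>2 * A $ j $ j" using A by (simp add: nonneg_symmetric_def)
    ultimately show ?thesis by linarith
  qed
  have "k \<le> A $ j $ i * x $ i" if "i \<noteq> j" for i
  proof -
    have "k \<le> x $ i" unfolding k using pos[OF that] by (intro Min_le) auto
    also have "\<dots> \<le> A $ j $ i * x $ i"
      using off[of j i] that pos[OF that] mult_right_mono[of 1 "A $ j $ i" "x $ i"] by auto
    finally show ?thesis .
  qed
  then have "(\<Sum>i\<in>-{j}. k) \<le> (\<Sum>i\<in>-{j}. A $ j $ i * x $ i)"
    by (intro sum_mono) auto
  also have "\<dots> = c"
    unfolding c_def matrix_vector_mult_def using xj
    by (auto intro!: sum.mono_neutral_left)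
  finally have kc: "k * (real CARD('n) - 1) \<le> c"
    by (simp add: Compl_eq_Diff_UNIV card_Diff_singleton of_nat_diff algebra_simps)
  from test[of 1] show "2 * k * (real CARD('n) - 1) \<le> 2 * r\<^sub>1 - r\<^sub>2"
    using kc by simp
  assume "2 * r\<^sub>1 - r\<^sub>2 = 2 * k * (real CARD('n) - 1)"
  then have eq: "2 * r\<^sub>1 - r\<^sub>2 = 2 * c" using kc test[of 1] by simp
  \<comment> \<open>The slack \<open>r\<^sub>1 * (1 + t\<^sup>2) - r\<^sub>2 - 2 * t * c\<close> is
    nonnegative and vanishes at \<open>t = 1\<close>, so its left derivative
    \<open>2 * (r\<^sub>1 - c)\<close> there cannot be positive. Here \<open>t = 1 - s\<close>, and
    \<open>s < 1\<close> keeps \<open>t\<close> nonnegative.\<close>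
  have "s * (2 * (r\<^sub>1 - c)) \<le> s\<^sup>2 * r\<^sub>1" if "0 < s" "s < 1" for s
  proof -
    have "r\<^sub>2 + 2 * c - 2 * (s * c) \<le> 2 * r\<^sub>1 - 2 * (s * r\<^sub>1) + s\<^sup>2 * r\<^sub>1"
      using test[of "1 - s"] that by (simp add: power2_eq_square algebra_simps)
    moreover have "s * (2 * (r\<^sub>1 - c)) = 2 * (s * r\<^sub>1) - 2 * (s * c)"
      by (simp add: algebra_simps)
    ultimately show ?thesis using eq by linarith
  qed
  from nonpos_if_linear_le_quadratic[OF this] have "r\<^sub>2 \<le> 0" using eq by simp
  show "CARD('n) = 2"
  proof (rule ccontr)
    assume "CARD('n) \<noteq> 2"
    then have "2 \<le> card (- {j})" using card by (simp add: Compl_eq_Diff_UNIV card_Diff_singleton)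
    then obtain T where "T \<subseteq> - {j}" "card T = 2"
      using obtain_subset_with_card_n[of 2 "- {j}"] by blast
    then obtain a b where "T = {a, b}" "a \<noteq> b"
      by (meson card_2_iff)
    with \<open>T \<subseteq> - {j}\<close> have ab: "a \<noteq> j" "b \<noteq> j" "a \<noteq> b"
      by auto
    \<comment> \<open>Two vertices in the support make \<open>(A *v x) $ a\<close> positive, which
      contradicts \<open>r\<^sub>2 \<le> 0\<close> through the eigenvalue equation at
      \<open>a\<close>.\<close>
    have "0 < A $ a $ b * x $ b" using off_pos ab pos by simp
    also have "\<dots> \<le> (A *v x) $ a"
      unfolding matrix_vector_mult_def using A x'(3)
      by (auto simp: nonneg_symmetric_def intro!: member_le_sum)
    also have "\<dots> = r\<^sub>2 * x $ a"
      using ab supp by (intro pareto_eigenvector_on_supp[OF x]) auto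
    finally show False using \<open>r\<^sub>2 \<le> 0\<close> pos[OF ab(1)]
      by (simp add: zero_less_mult_iff)
  qed
qed

text \<open>Here \<open>x\<close> is a basis vector, so \<open>k = 1\<close> and
  \<open>r\<^sub>2 = 0\<close>. It remains to see that \<open>r\<^sub>1 = 1\<close>.\<close>

lemma pareto_eigenvalue_gap_order_2:
  assumes norm: "norm x = 1" and k: "k = Min {x $ i | i. 0 < x $ i}"
    and order: "CARD('n) = 2"
    and diag: "\<And>i. A $ i $ i = 0" and off_eq: "\<And>i j. i \<noteq> j \<Longrightarrow> A $ i $ j = 1"
  shows "2 * r\<^sub>1 - r\<^sub>2 = 2 * k * (real CARD('n) - 1)"
proof -
  obtain j where supp: "supp x = - {j}" by (rule supp_second_eigenvector)
  have "card (- {j}) = 1" using order by (simp add: Compl_eq_Diff_UNIV card_Diff_singleton)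
  then obtain i where i: "- {j} = {i}" by (auto simp: card_1_singleton_iff)
  then have "UNIV = {i, j}" and "i \<noteq> j" by auto
  then have sum: "sum f UNIV = f i + f j" for f :: "'n \<Rightarrow> real"
    unfolding \<open>UNIV = {i, j}\<close> by simp
  note x' = pareto_eigenvectorD[OF x]
  have "x $ j = 0" using supp by (auto simp: supp_def)
  moreover have "x \<bullet> x = 1" using norm by (simp add: norm_eq_1)
  ultimately have "x $ i * x $ i = 1"
    using \<open>i \<noteq> j\<close> by (simp add: inner_vec_def sum)
  then have xi: "x $ i = 1"
    using x'(3)[of i] by (auto simp: square_eq_1_iff)
  have "x $ l = 1" if "0 < x $ l" for l
  proof -
    have "l \<noteq> j" using that \<open>x $ j = 0\<close> by auto
    then have "l = i" using i by blast
    then show ?thesis using xi by simp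
  qed
  then have "{x $ l | l. 0 < x $ l} = {1}"
    using xi by force
  then have "k = 1" using k by simp
  have form: "z \<bullet> (A *v z) = 2 * z $ i * z $ j" for z
    using \<open>i \<noteq> j\<close> off_eq by (simp add: inner_vec_def matrix_vector_mult_def sum diag)
  have "r\<^sub>2 = 0" using x'(5) form[of x] \<open>x $ j = 0\<close> \<open>x \<bullet> x = 1\<close> by simp
  obtain z where z: "pareto_eigenvector A r\<^sub>1 z"
    using largest_pareto_eigenvalue(1) by (auto simp: pareto_eigenvalues_def)
  have "r\<^sub>1 * (z \<bullet> z) = 2 * z $ i * z $ j"
    using pareto_eigenvectorD(5)[OF z] form by simp
  \<comment> \<open>The bound \<open>r\<^sub>1 \<le> 1\<close> is the inequality of arithmetic and
    geometric means; the reverse bound is the gap inequality, which now reads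
    \<open>2 \<le> 2 * r\<^sub>1\<close>.\<close>
  also have "\<dots> \<le> z \<bullet> z"
    using \<open>i \<noteq> j\<close> sum_squares_bound[of "z $ i" "z $ j"]
    by (simp add: inner_vec_def sum power2_eq_square)
  finally have "r\<^sub>1 \<le> 1" using pareto_eigenvectorD(6)[OF z] by simp
  with pareto_eigenvalue_gap(1)[OF norm k] show ?thesis
    using \<open>k = 1\<close> \<open>r\<^sub>2 = 0\<close> order by simp
qed

end

section \<open>Distances in symmetric digraphs\<close>

text \<open>Replace each arc by an opposite one and reverse the order. This yields the symmetry of
  the distance matrix.\<close>

lemma (in sym_digraph) awalk_reverse:
  assumes "awalk u p v"
  shows "\<exists>q. awalk v q u \<and> length q = length p"
  using assms
proof (induction p arbitrary: u)
  case (Cons e p)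
  then have e: "e \<in> arcs G" "u = tail G e" "awalk (head G e) p v"
    by (auto simp: awalk_Cons_iff)
  obtain q where q: "awalk v q (head G e)" "length q = length p"
    using Cons.IH[OF e(3)] by blast
  obtain e' where "e' \<in> arcs G" "tail G e' = head G e" "head G e' = tail G e"
    using sym_arcs e(1) unfolding symmetric_conv by metis
  then have "awalk (head G e) [e'] u" using e(1,2) by (auto simp: awalk_Cons_iff awalk_Nil_iff)
  then have "awalk v (q @ [e']) u" using q by (auto intro: awalk_appendI)
  then show ?case using q by (intro exI[of _ "q @ [e']"]) auto
qed (auto simp: awalk_Nil_iff)

lemma (in sym_digraph) graph_dist_commute: "graph_dist G u v = graph_dist G v u"
proof -
  have "awalk_cost (\<lambda>_. 1) p = real (length p)" for p
    by (induct p) auto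
  \<comment> \<open>Comparing infima over walks also covers pairs that no walk joins.\<close>
  then have "\<mu> (\<lambda>_. 1) u v \<le> \<mu> (\<lambda>_. 1) v u" for u v
    unfolding \<mu>_def using awalk_reverse
    by (intro INF_mono) (metis (no_types, lifting) mem_Collect_eq order_refl)
  then have "\<mu> (\<lambda>_. 1) u v = \<mu> (\<lambda>_. 1) v u" by (intro antisym)
  then show ?thesis by (simp add: graph_dist_def)
qed

context
  fixes G :: "('v, 'e) pre_digraph" and u v :: 'v
  assumes wf: "wf_digraph G" and reach: "u \<rightarrow>\<^sup>*\<^bsub>G\<^esub> v"
begin

interpretation wf_digraph G by (fact wf)

lemma graph_dist_le:
  assumes "apath u p v"
  shows "graph_dist G u v \<le> real (length p)"
  unfolding graph_dist_Least[OF wf reach] using assms by (auto intro: Least_le)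

lemma one_le_graph_dist:
  assumes "u \<noteq> v"
  shows "1 \<le> graph_dist G u v"
proof -
  let ?P = "\<lambda>l. \<exists>p. apath u p v \<and> length p = l"
  obtain p where "apath u p v" using reach by (auto simp: reachable_apath)
  then have "\<exists>l. ?P l" by blast
  then have "?P (LEAST l. ?P l)" by (rule LeastI_ex)
  \<comment> \<open>The empty path joins a vertex only to itself.\<close>
  moreover have "\<not> ?P 0" using assms by (auto simp: apath_def awalk_Nil_iff)
  ultimately have "0 < (LEAST l. ?P l)" by (metis gr0I)
  then show ?thesis unfolding graph_dist_Least[OF wf reach] by linarith
qed

lemma graph_dist_nonneg: "0 \<le> graph_dist G u v"
  unfolding graph_dist_Least[OF wf reach] by simp

end

lemma graph_dist_self:
  assumes "wf_digraph G" "u \<in> verts G"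
  shows "graph_dist G u u = 0"
proof -
  interpret wf_digraph G by fact
  have "u \<rightarrow>\<^sup>*\<^bsub>G\<^esub> u" using assms(2) by simp
  moreover have "apath u [] u" using assms(2) by (simp add: apath_Nil_iff)
  ultimately show ?thesis
    using graph_dist_le[OF assms(1), of u u "[]"] graph_dist_nonneg[OF assms(1), of u u] by simp
qed

text \<open>The arc alone is a path of length 1, which meets the lower bound for distinct
  vertices.\<close>

lemma graph_dist_adjacent:
  assumes "wf_digraph G" "u \<rightarrow>\<^bsub>G\<^esub> v" "u \<noteq> v"
  shows "graph_dist G u v = 1"
proof -
  interpret wf_digraph G by fact
  obtain e where e: "e \<in> arcs G" "tail G e = u" "head G e = v"
    using assms(2) by (auto simp: arcs_ends_conv)
  then have "apath u [e] v" using assms(3)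
    by (auto simp: apath_def awalk_Cons_iff awalk_Nil_iff)
  moreover have "u \<rightarrow>\<^sup>*\<^bsub>G\<^esub> v" using assms(2) by (rule reachable_adjI)
  ultimately show ?thesis
    using graph_dist_le[OF assms(1), of u v "[e]"] one_le_graph_dist[OF assms(1), of u v] assms(3)
    by simp
qed

text \<open>The library's connectedness disregards the direction of arcs; for symmetric arcs it
  gives directed reachability.\<close>

lemma (in sym_digraph) reachable_if_connected:
  assumes "Digraph_Component.connected G" "u \<in> verts G" "v \<in> verts G"
  shows "u \<rightarrow>\<^sup>* v"
  using symmetric_connected_imp_strongly_connected[OF sym_arcs assms(1)] assms(2,3)
  by (simp add: strongly_connected_def)

section \<open>The complete graph on two vertices and the final theorem\<close>

text \<open>Translates the equality case, obtained as a condition on the order, into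
  \<open>K_2\<close>.\<close>

lemma complete_digraph_2_iff:
  fixes G :: "('v::finite, 'e) pre_digraph"
  assumes "graph G" "verts G = UNIV" "Digraph_Component.connected G"
  shows "complete_digraph 2 G \<longleftrightarrow> CARD('v) = 2"
proof
  assume card: "CARD('v) = 2"
  interpret graph G by fact
  have "u \<rightarrow>\<^bsub>G\<^esub> v" if "u \<noteq> v" for u v
  proof -
    have "u \<rightarrow>\<^sup>*\<^bsub>G\<^esub> v"
      using reachable_if_connected[OF assms(3)] assms(2) by simp
    then obtain w where w: "u \<rightarrow>\<^bsub>G\<^esub> w"
      using \<open>u \<noteq> v\<close> by (metis converse_reachable_cases)
    then have "w \<noteq> u" using adj_not_same by auto
    moreover have "UNIV = {u, v}"
      using that card by (intro card_seteq[symmetric]) auto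
    ultimately show ?thesis using w by (metis UNIV_I insertE singletonD)
  qed
  then show "complete_digraph 2 G"
    using assms card adj_not_same by (auto simp: complete_digraph_def)
qed (use assms in \<open>auto simp: complete_digraph_def\<close>)

theorem theorem2p19:
  fixes G :: "('v::finite, 'e) pre_digraph"
    and n :: nat
    and x :: "real ^ 'v"
    and k \<rho>\<^sub>1 \<rho>\<^sub>2 :: real
  assumes "graph G" and "verts G = UNIV" and "Digraph_Component.connected G"
    and "n = CARD('v)" and "n \<ge> 2"
    and "\<rho>\<^sub>1 = distance_pareto_rho 1 G"
    and "\<rho>\<^sub>2 = distance_pareto_rho 2 G"
    and "pareto_eigenvector (distance_matrix G) \<rho>\<^sub>2 x" and "norm x = 1"
    and "k = Min {x $ i | i. 0 < x $ i}"
  shows "2 * \<rho>\<^sub>1 - \<rho>\<^sub>2 \<ge> 2 * k * (real n - 1) \<and>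
         (2 * \<rho>\<^sub>1 - \<rho>\<^sub>2 = 2 * k * (real n - 1) \<longleftrightarrow> complete_digraph 2 G)"
proof -
  interpret graph G by fact
  let ?D = "distance_matrix G"
  have reach: "u \<rightarrow>\<^sup>*\<^bsub>G\<^esub> v" for u v
    using reachable_if_connected[OF assms(3)] assms(2) by simp
  have D: "nonneg_symmetric ?D"
    using graph_dist_commute graph_dist_nonneg[OF wf_digraph reach]
    by (auto simp: nonneg_symmetric_def distance_matrix_def transpose_def vec_eq_iff)
  have off: "1 \<le> ?D $ i $ j" if "i \<noteq> j" for i j
    using one_le_graph_dist[OF wf_digraph reach that] by (simp add: distance_matrix_def)
  note gap = pareto_eigenvalue_gap[OF D off assms(5)[unfolded assms(4)]
      assms(6,7)[unfolded distance_pareto_rho_def] assms(8-10)]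
  note gap_2 = pareto_eigenvalue_gap_order_2[OF D off assms(5)[unfolded assms(4)]
      assms(6,7)[unfolded distance_pareto_rho_def] assms(8-10)]
  have "2 * \<rho>\<^sub>1 - \<rho>\<^sub>2 = 2 * k * (real n - 1)" if K2: "complete_digraph 2 G"
  proof -
    have "?D $ i $ i = 0" for i
      using graph_dist_self[OF wf_digraph] assms(2) by (simp add: distance_matrix_def)
    moreover have "?D $ i $ j = 1" if "i \<noteq> j" for i j
      using graph_dist_adjacent[OF wf_digraph _ that] K2 that assms(2)
      by (simp add: distance_matrix_def complete_digraph_def)
    ultimately show ?thesis
      using gap_2 complete_digraph_2_iff[OF assms(1-3)] K2 assms(4) by simp
  qed
  then show ?thesis
    using gap complete_digraph_2_iff[OF assms(1-3)] assms(4) by blast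
qed

end
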